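(* Let $N\ge1$ be an integer and $m>0$. For any $s\in(0,1)$ and $u,v\in\mathcal S(\mathbb{R}^N)$, $$\int_{\mathbb{R}^N}\left[(-\Delta+m^2)^su(x)\right]v(x)\,dx=\int_{\mathbb{R}^N}u(x)\left[(-\Delta+m^2)^sv(x)\right]dx.$$
   Context: $\mathcal S(\mathbb{R}^N)$ is the Schwartz space. Fourier transform: $\hat f(\xi)=\mathcal F(f)(\xi)=\int_{\mathbb{R}^N}e^{-2\pi i x\cdot\xi}f(x)\,dx$. For $s\in(0,1)$, $(-\Delta+m^2)^sf=\mathcal F^{-1}\big((m^2+4\pi^2|\cdot|^2)^s\hat f\big)$. *)

theory Defs
  imports "HOL-Analysis.Analysis"
begin

text \<open>
  A list of basis vectors \<open>[b\<^sub>1, \<dots>, b\<^sub>k]\<close> encodes a multi-index, each basis vector being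
  repeated as often as the multi-index prescribes.
\<close>

primrec iter_partial ::
  "'a::euclidean_space list \<Rightarrow> ('a \<Rightarrow> complex) \<Rightarrow> 'a \<Rightarrow> complex" where
  "iter_partial [] f = f"
| "iter_partial (b # bs) f = (\<lambda>x. frechet_derivative (iter_partial bs f) (at x) b)"

text \<open>
  Total differentiability of the iterated partial derivatives of every order is equivalent to
  smoothness. It also rules out the arbitrary values that \<open>frechet_derivative\<close> takes at points of
  non-differentiability.
\<close>

definition smooth :: "('a::euclidean_space \<Rightarrow> complex) \<Rightarrow> bool" where
  "smooth f \<longleftrightarrow> (\<forall>bs \<in> lists Basis. \<forall>x. iter_partial bs f differentiable (at x))"

definition schwartz_space :: "('a::euclidean_space \<Rightarrow> complex) set" where
  "schwartz_space =
     {f. smooth f \<and>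
         (\<forall>bs \<in> lists Basis. \<forall>k::nat. \<exists>C. \<forall>x. norm x ^ k * norm (iter_partial bs f x) \<le> C)}"

definition fourier :: "('a::euclidean_space \<Rightarrow> complex) \<Rightarrow> 'a \<Rightarrow> complex" where
  "fourier f \<xi> =
     (LINT x|lborel. exp (- 2 * complex_of_real pi * \<i> * complex_of_real (x \<bullet> \<xi>)) * f x)"

definition inv_fourier :: "('a::euclidean_space \<Rightarrow> complex) \<Rightarrow> 'a \<Rightarrow> complex" where
  "inv_fourier g x =
     (LINT \<xi>|lborel. exp (2 * complex_of_real pi * \<i> * complex_of_real (x \<bullet> \<xi>)) * g \<xi>)"

text \<open>The operator \<open>(-\<Delta> + m\<^sup>2)\<^sup>s\<close>.\<close>

definition frac_op ::
  "real \<Rightarrow> real \<Rightarrow> ('a::euclidean_space \<Rightarrow> complex) \<Rightarrow> 'a \<Rightarrow> complex" where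
  "frac_op m s f =
     inv_fourier
       (\<lambda>\<xi>. complex_of_real ((m\<^sup>2 + 4 * pi\<^sup>2 * (norm \<xi>)\<^sup>2) powr s) * fourier f \<xi>)"

end

theory Submission
  imports Defs "HOL-Probability.Sinc_Integral"
begin

text \<open>
  Write \<open>Fu\<close> for the Fourier transform of \<open>u\<close> and \<open>w\<close> for the symbol of the operator. Fubini
  turns the left-hand side into \<open>\<integral> w(\<xi>) Fu(\<xi>) Fv(-\<xi>) d\<xi>\<close>, and since \<open>w\<close> is even the reflection
  \<open>\<xi> \<mapsto> -\<xi>\<close> exchanges the roles of \<open>u\<close> and \<open>v\<close>. Fubini needs \<open>w Fu\<close> to be integrable; it suffices
  that \<open>Fu\<close> decays rapidly, which follows from \<open>F(\<partial>\<^sub>b u)(\<xi>) = 2\<pi>\<i> (b \<bullet> \<xi>) Fu(\<xi>)\<close>. Instead of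
  integrating by parts, this identity is obtained by comparing \<open>u\<close> with its translates: the transform
  of \<open>(u(x + hb) - u(x)) / h\<close> is \<open>(exp(2\<pi>\<i> h (b \<bullet> \<xi>)) - 1) / h\<close> times \<open>Fu(\<xi>)\<close>, and \<open>h\<close> tends to
  \<open>0\<close> by dominated convergence.
\<close>

section \<open>Integrability of rapidly decreasing functions\<close>

text \<open>Decay is separated from smoothness, so that it can be asserted of Fourier transforms and
  of their products with the symbol, where nothing about derivatives is proved.\<close>

definition rapidly_decreasing :: "('a::real_normed_vector \<Rightarrow> 'b::real_normed_vector) \<Rightarrow> bool" where
  "rapidly_decreasing f \<longleftrightarrow> (\<forall>k::nat. \<exists>C. \<forall>x. norm x ^ k * norm (f x) \<le> C)"

text \<open>With \<open>M = max 1 (r\<^sup>2)\<close> the base is at most \<open>2 * M\<close>, and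
  \<open>M ^ n\<close> is one of \<open>1\<close> and \<open>r ^ (2 * n)\<close>.\<close>

lemma one_plus_square_power_le:
  fixes r :: real
  shows "(1 + r\<^sup>2) ^ n \<le> 2 ^ n * (1 + r ^ (2 * n))"
proof -
  have "(1 + r\<^sup>2) ^ n \<le> (2 * max 1 (r\<^sup>2)) ^ n"
    by (intro power_mono) auto
  also have "\<dots> = 2 ^ n * max 1 (r\<^sup>2) ^ n"
    by (simp add: power_mult_distrib)
  also have "max 1 (r\<^sup>2) ^ n \<le> 1 + (r\<^sup>2) ^ n"
    by (auto simp: max_def)
  finally show ?thesis
    by (simp add: power_mult)
qed

text \<open>The bounds of orders \<open>0\<close> and \<open>2 * n\<close> merge into a single
  majorant without singularity at the origin; for \<open>n = DIM('a)\<close> it is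
  integrable.\<close>

lemma rapidly_decreasing_bound:
  assumes "rapidly_decreasing f"
  obtains C where "C \<ge> 0" "\<And>x. norm (f x) \<le> C / (1 + (norm x)\<^sup>2) ^ n"
proof -
  obtain A B where A: "\<And>x. norm x ^ 0 * norm (f x) \<le> A"
    and B: "\<And>x. norm x ^ (2 * n) * norm (f x) \<le> B"
    using assms unfolding rapidly_decreasing_def by meson
  have bd: "(1 + (norm x)\<^sup>2) ^ n * norm (f x) \<le> 2 ^ n * (A + B)" for x
  proof -
    have "(1 + (norm x)\<^sup>2) ^ n * norm (f x) \<le> 2 ^ n * (1 + norm x ^ (2 * n)) * norm (f x)"
      by (intro mult_right_mono one_plus_square_power_le) auto
    also have "\<dots> = 2 ^ n * (norm x ^ 0 * norm (f x) + norm x ^ (2 * n) * norm (f x))"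
      by (simp add: algebra_simps)
    also have "\<dots> \<le> 2 ^ n * (A + B)"
      by (intro mult_left_mono add_mono A B) auto
    finally show ?thesis .
  qed
  show thesis
  proof
    \<comment> \<open>At the point 0 the constant dominates a nonnegative quantity.\<close>
    show "2 ^ n * (A + B) \<ge> 0"
      by (rule order_trans[OF _ bd[of 0]]) auto
    have "(1 + (norm x)\<^sup>2) ^ n > 0" for x :: 'a
      by (intro zero_less_power) (simp add: add_pos_nonneg)
    then show "norm (f x) \<le> 2 ^ n * (A + B) / (1 + (norm x)\<^sup>2) ^ n" for x
      using bd[of x] by (simp add: pos_le_divide_eq mult.commute)
  qed
qed

text \<open>Each coordinate is at most the norm in absolute value, so the function lies below a
  product of one-dimensional factors, one per basis vector. The integral of that product factorizes
  into finite integrals over the line.\<close>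

lemma integrable_inverse_one_plus_norm_power:
  "integrable lborel (\<lambda>x::'a::euclidean_space. 1 / (1 + (norm x)\<^sup>2) ^ DIM('a))"
proof (rule Bochner_Integration.integrable_bound)
  have 1: "integrable lborel (\<lambda>x::real. inverse (1 + x\<^sup>2))"
    using integrable_inverse_1_plus_square by (simp add: set_integrable_def einterval_eq)
  have "(\<integral>\<^sup>+x. (\<Prod>b\<in>Basis. ennreal (inverse (1 + ((x::'a) \<bullet> b)\<^sup>2))) \<partial>lborel)
      = (\<Prod>b\<in>(Basis::'a set). \<integral>\<^sup>+x. ennreal (inverse (1 + x\<^sup>2)) \<partial>lborel)"
    by (rule nn_integral_lborel_prod) auto
  also have "\<dots> < \<infinity>"
    using 1 by (simp add: integrable_iff_bounded power_less_top_ennreal)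
  finally show "integrable lborel (\<lambda>x::'a. \<Prod>b\<in>Basis. inverse (1 + (x \<bullet> b)\<^sup>2))"
    by (simp add: integrable_iff_bounded prod_ennreal abs_prod)
  show "AE x in lborel. norm (1 / (1 + (norm (x::'a))\<^sup>2) ^ DIM('a))
      \<le> norm (\<Prod>b\<in>Basis. inverse (1 + (x \<bullet> b)\<^sup>2))"
  proof (rule AE_I2)
    fix x :: 'a
    have "(\<Prod>b\<in>(Basis::'a set). inverse (1 + (norm x)\<^sup>2)) \<le> (\<Prod>b\<in>Basis. inverse (1 + (x \<bullet> b)\<^sup>2))"
    proof (intro prod_mono conjI le_imp_inverse_le add_left_mono)
      fix b :: 'a assume "b \<in> Basis"
      then show "(x \<bullet> b)\<^sup>2 \<le> (norm x)\<^sup>2"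
        using Basis_le_norm[of b x] by (metis abs_le_square_iff abs_norm_cancel)
    qed (auto simp: add_pos_nonneg)
    then show "norm (1 / (1 + (norm x)\<^sup>2) ^ DIM('a)) \<le> norm (\<Prod>b\<in>Basis. inverse (1 + (x \<bullet> b)\<^sup>2))"
      by (simp add: abs_prod power_one_over inverse_eq_divide)
  qed
qed auto

lemma rapidly_decreasing_integrable:
  fixes f :: "'a::euclidean_space \<Rightarrow> complex"
  assumes "f \<in> borel_measurable borel" and "rapidly_decreasing f"
  shows "integrable lborel f"
proof -
  obtain C where C: "C \<ge> 0" "\<And>x. norm (f x) \<le> C / (1 + (norm x)\<^sup>2) ^ DIM('a)"
    using rapidly_decreasing_bound[OF assms(2)] by metis
  show ?thesis
  proof (rule Bochner_Integration.integrable_bound)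
    show "integrable lborel (\<lambda>x::'a. C * (1 / (1 + (norm x)\<^sup>2) ^ DIM('a)))"
      by (intro integrable_mult_right integrable_inverse_one_plus_norm_power)
    show "AE x in lborel. norm (f x) \<le> norm (C * (1 / (1 + (norm x)\<^sup>2) ^ DIM('a)))"
      using C by (intro AE_I2) (simp add: abs_of_nonneg)
  qed (use assms(1) in simp)
qed

section \<open>Schwartz functions\<close>

lemma iter_partial_append:
  "iter_partial (as @ bs) f = iter_partial as (iter_partial bs f)"
  by (induction as) auto

text \<open>Derivatives of \<open>iter_partial bs f\<close> are derivatives of \<open>f\<close>
  along a concatenated list, so each required bound is already one of those for
  \<open>f\<close>.\<close>

lemma schwartz_iter_partial:
  assumes "f \<in> schwartz_space" and "bs \<in> lists Basis"
  shows "iter_partial bs f \<in> schwartz_space"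
  using assms unfolding schwartz_space_def smooth_def
  by (auto simp flip: iter_partial_append)

lemma schwartz_rapidly_decreasing:
  assumes "f \<in> schwartz_space"
  shows "rapidly_decreasing f"
  using assms unfolding schwartz_space_def rapidly_decreasing_def
  by (auto dest!: bspec[where x = "[]"])

lemma schwartz_differentiable:
  assumes "f \<in> schwartz_space"
  shows "f differentiable (at x)"
  using assms unfolding schwartz_space_def smooth_def
  by (auto dest!: bspec[where x = "[]"])

lemma schwartz_borel_measurable:
  assumes "f \<in> schwartz_space"
  shows "f \<in> borel_measurable borel"
  using schwartz_differentiable[OF assms]
  by (intro borel_measurable_continuous_onI continuous_at_imp_continuous_on)
     (auto intro: differentiable_imp_continuous_within)

lemma schwartz_integrable:
  fixes f :: "'a::euclidean_space \<Rightarrow> complex"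
  assumes "f \<in> schwartz_space"
  shows "integrable lborel f"
  using assms by (intro rapidly_decreasing_integrable schwartz_borel_measurable
      schwartz_rapidly_decreasing)

text \<open>Chain rule along a line. The set \<open>T\<close> is arbitrary because the mean value
  inequality takes \<open>{0..h}\<close> and the limit of difference quotients takes
  \<open>UNIV\<close>.\<close>

lemma schwartz_line_derivative:
  assumes "f \<in> schwartz_space"
  shows "((\<lambda>t. f (x + t *\<^sub>R b)) has_vector_derivative iter_partial [b] f (x + t *\<^sub>R b))
    (at t within T)"
proof -
  have line: "((\<lambda>t. x + t *\<^sub>R b) has_derivative (\<lambda>h. h *\<^sub>R b)) (at t within T)"
    by (auto intro!: derivative_eq_intros)
  have "(f has_derivative frechet_derivative f (at (x + t *\<^sub>R b))) (at (x + t *\<^sub>R b))"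
    using schwartz_differentiable[OF assms] by (simp add: frechet_derivative_works)
  from has_derivative_compose[OF line this]
  have "((\<lambda>t. f (x + t *\<^sub>R b)) has_derivative
      (\<lambda>h. frechet_derivative f (at (x + t *\<^sub>R b)) (h *\<^sub>R b))) (at t within T)" .
  moreover have "frechet_derivative f (at y) (h *\<^sub>R b) = h *\<^sub>R frechet_derivative f (at y) b" for h y
    using linear_frechet_derivative[OF schwartz_differentiable[OF assms]] by (rule linear_cmul)
  ultimately show ?thesis
    by (simp add: has_vector_derivative_def)
qed

text \<open>Weights at points of distance at most 1 are comparable:
  \<open>norm x \<le> norm y + 1\<close>, and
  \<open>(norm y + 1)\<^sup>2 \<le> 2 * (norm y)\<^sup>2 + 2\<close>.\<close>

lemma one_plus_norm_square_shift:
  fixes x y :: "'a::real_normed_vector"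
  assumes "norm (x - y) \<le> 1"
  shows "1 + (norm x)\<^sup>2 \<le> 3 * (1 + (norm y)\<^sup>2)"
proof -
  have "norm x \<le> norm y + 1"
    using assms norm_triangle_ineq2[of x y] by linarith
  then have "(norm x)\<^sup>2 \<le> (norm y + 1)\<^sup>2"
    by (intro power_mono) auto
  moreover have "2 * norm y \<le> (norm y)\<^sup>2 + 1"
    using zero_le_power2[of "norm y - 1"] by (simp add: power2_eq_square algebra_simps)
  moreover have "(norm y + 1)\<^sup>2 = (norm y)\<^sup>2 + 2 * norm y + 1"
    by (simp add: power2_eq_square algebra_simps)
  ultimately show ?thesis
    using zero_le_power2[of "norm y"] by (simp only: distrib_left)
qed

text \<open>Supplies a majorant independent of \<open>h\<close> for dominated convergence. The mean
  value inequality bounds the quotient by the derivative on the segment from \<open>x\<close> to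
  \<open>x + h *\<^sub>R b\<close>; this segment stays within distance 1 of \<open>x\<close>, so the
  decay of the derivative carries over to \<open>x\<close> at the cost of
  \<open>3 ^ DIM('a)\<close>.\<close>

lemma schwartz_difference_quotient_bound:
  fixes f :: "'a::euclidean_space \<Rightarrow> complex"
  assumes f: "f \<in> schwartz_space" and b: "b \<in> Basis"
  obtains C where "\<And>x h. 0 < h \<Longrightarrow> h \<le> 1 \<Longrightarrow>
    norm ((f (x + h *\<^sub>R b) - f x) /\<^sub>R h) \<le> C / (1 + (norm x)\<^sup>2) ^ DIM('a)"
proof -
  let ?n = "DIM('a)"
  have "rapidly_decreasing (iter_partial [b] f)"
    using b by (intro schwartz_rapidly_decreasing schwartz_iter_partial f) auto
  then obtain C where C: "C \<ge> 0"
    "\<And>x. norm (iter_partial [b] f x) \<le> C / (1 + (norm x)\<^sup>2) ^ ?n"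
    using rapidly_decreasing_bound by metis
  show thesis
  proof
    fix x :: 'a and h :: real assume h: "0 < h" "h \<le> 1"
    let ?B = "C * 3 ^ ?n / (1 + (norm x)\<^sup>2) ^ ?n"
    have bd: "norm (iter_partial [b] f (x + t *\<^sub>R b)) \<le> ?B" if "t \<in> {0..h}" for t
    proof -
      let ?y = "x + t *\<^sub>R b"
      have pos: "1 + (norm z)\<^sup>2 > 0" for z :: 'a
        by (simp add: add_pos_nonneg)
      have "1 + (norm x)\<^sup>2 \<le> 3 * (1 + (norm ?y)\<^sup>2)"
        using that h b by (intro one_plus_norm_square_shift) simp
      then have "(1 + (norm x)\<^sup>2) ^ ?n \<le> (3 * (1 + (norm ?y)\<^sup>2)) ^ ?n"
        using pos[of x] by (intro power_mono) auto
      then have le: "(1 + (norm x)\<^sup>2) ^ ?n \<le> 3 ^ ?n * (1 + (norm ?y)\<^sup>2) ^ ?n"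
        by (simp only: power_mult_distrib)
      have "norm (iter_partial [b] f ?y) \<le> C / (1 + (norm ?y)\<^sup>2) ^ ?n"
        by (rule C)
      also have "\<dots> = C * 3 ^ ?n / (3 ^ ?n * (1 + (norm ?y)\<^sup>2) ^ ?n)"
        by simp
      also have "\<dots> \<le> ?B"
        using pos[of x] C(1) by (intro divide_left_mono le mult_nonneg_nonneg) (auto simp: pos)
      finally show ?thesis .
    qed
    have "norm (f (x + h *\<^sub>R b) - f (x + 0 *\<^sub>R b)) \<le> ?B * norm (h - 0)"
    proof (rule differentiable_bound[where S = "{0..h}" and f = "\<lambda>t. f (x + t *\<^sub>R b)"])
      show "((\<lambda>t. f (x + t *\<^sub>R b)) has_derivative
          (\<lambda>s. s *\<^sub>R iter_partial [b] f (x + t *\<^sub>R b))) (at t within {0..h})" for t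
        using schwartz_line_derivative[OF f] by (simp add: has_vector_derivative_def)
      show "onorm (\<lambda>s. s *\<^sub>R iter_partial [b] f (x + t *\<^sub>R b)) \<le> ?B" if "t \<in> {0..h}" for t
      proof (rule onorm_le)
        show "norm (s *\<^sub>R iter_partial [b] f (x + t *\<^sub>R b)) \<le> ?B * norm s" for s
          using mult_right_mono[OF bd[OF that] abs_ge_zero[of s]]
          by (simp only: norm_scaleR real_norm_def mult.commute)
      qed
    qed (use h in auto)
    then have "norm (f (x + h *\<^sub>R b) - f x) / h \<le> ?B"
      using h by (subst pos_divide_le_eq) auto
    then show "norm ((f (x + h *\<^sub>R b) - f x) /\<^sub>R h) \<le> ?B"
      using h by (simp only: norm_scaleR) (simp add: divide_inverse mult.commute)
  qed
qed

section \<open>The Fourier transform of a Schwartz function\<close>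

abbreviation character :: "'a::euclidean_space \<Rightarrow> 'a \<Rightarrow> complex" where
  "character \<xi> x \<equiv> exp (- 2 * complex_of_real pi * \<i> * complex_of_real (x \<bullet> \<xi>))"

lemma norm_character: "norm (character \<xi> x) = 1"
  by (simp add: norm_exp_eq_Re)

lemma integrable_character_mult:
  fixes f :: "'a::euclidean_space \<Rightarrow> complex"
  assumes "integrable lborel f"
  shows "integrable lborel (\<lambda>x. character \<xi> x * f x)"
proof -
  note [measurable] = borel_measurable_integrable[OF assms, simplified]
  show ?thesis
    using assms
    by (rule Bochner_Integration.integrable_bound)
       (measurable, auto simp only: norm_mult norm_character intro!: AE_I2)
qed

text \<open>The kernel has modulus 1. For a non-integrable \<open>f\<close> the left-hand side is
  the default value 0.\<close>

lemma norm_fourier_le: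
  fixes f :: "'a::euclidean_space \<Rightarrow> complex"
  shows "norm (fourier f \<xi>) \<le> (LINT x|lborel. norm (f x))"
  unfolding fourier_def by (rule order_trans[OF integral_norm_bound]) (simp add: norm_mult norm_character)

lemma fourier_borel_measurable:
  fixes f :: "'a::euclidean_space \<Rightarrow> complex"
  assumes [measurable]: "f \<in> borel_measurable borel"
  shows "fourier f \<in> borel_measurable borel"
  unfolding fourier_def[abs_def] by measurable

lemma
  fixes f :: "'a::euclidean_space \<Rightarrow> complex"
  assumes [measurable]: "f \<in> borel_measurable borel"
  shows lborel_integral_translate: "(LINT x|lborel. f (x + a)) = (LINT x|lborel. f x)"
    and lborel_integral_reflect: "(LINT x|lborel. f (- x)) = (LINT x|lborel. f x)"
proof -
  have "(LINT x|distr lborel borel ((+) a). f x) = (LINT x|lborel. f (a + x))"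
    by (rule integral_distr) measurable
  then show "(LINT x|lborel. f (x + a)) = (LINT x|lborel. f x)"
    by (simp add: lborel_distr_plus add.commute)
next
  \<comment> \<open>Scaling by -1 changes Lebesgue measure by the factor
    \<open>\<bar>-1\<bar> ^ DIM('a) = 1\<close>.\<close>
  have "distr lborel borel uminus = (lborel :: 'a measure)"
    using lborel_affine[of "-1" "0::'a"] by (simp add: density_1)
  moreover have "(LINT x|distr lborel borel uminus. f x) = (LINT x|lborel. f (- x))"
    by (rule integral_distr) measurable
  ultimately show "(LINT x|lborel. f (- x)) = (LINT x|lborel. f x)"
    by simp
qed

section \<open>Translation and differentiation under the Fourier transform\<close>

lemma fourier_translate:
  fixes f :: "'a::euclidean_space \<Rightarrow> complex"
  assumes [measurable]: "f \<in> borel_measurable borel"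
  shows "fourier (\<lambda>x. f (x + a)) \<xi> = exp (2 * pi * \<i> * (a \<bullet> \<xi>)) * fourier f \<xi>"
proof -
  have eq: "character \<xi> x = exp (2 * pi * \<i> * (a \<bullet> \<xi>)) * character \<xi> (x + a)" for x
    unfolding exp_add[symmetric]
    by (rule arg_cong[where f = exp]) (simp add: inner_add_left algebra_simps)
  have "fourier (\<lambda>x. f (x + a)) \<xi>
      = (LINT x|lborel. exp (2 * pi * \<i> * (a \<bullet> \<xi>)) * (character \<xi> (x + a) * f (x + a)))"
    unfolding fourier_def mult.assoc[symmetric]
    by (subst eq) (rule refl)
  also have "\<dots> = exp (2 * pi * \<i> * (a \<bullet> \<xi>)) * (LINT x|lborel. character \<xi> (x + a) * f (x + a))"
    by (rule integral_mult_right_zero)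
  also have "(LINT x|lborel. character \<xi> (x + a) * f (x + a)) = fourier f \<xi>"
    unfolding fourier_def by (rule lborel_integral_translate) measurable
  finally show ?thesis .
qed

lemma fourier_difference_quotient:
  fixes f :: "'a::euclidean_space \<Rightarrow> complex"
  assumes "f \<in> schwartz_space"
  shows "fourier (\<lambda>x. (f (x + h *\<^sub>R b) - f x) /\<^sub>R h) \<xi>
    = ((exp (2 * pi * \<i> * (h * (b \<bullet> \<xi>))) - 1) /\<^sub>R h) * fourier f \<xi>"
proof -
  note [measurable] = schwartz_borel_measurable[OF assms]
  have int: "integrable lborel f"
    by (rule schwartz_integrable[OF assms])
  have "integrable lborel (\<lambda>x. f (x + h *\<^sub>R b))"
    using int integrable_distr_eq[of "(+) (h *\<^sub>R b)" lborel borel f]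
    by (simp add: lborel_distr_plus add.commute)
  note ints = integrable_character_mult[OF this, of \<xi>] integrable_character_mult[OF int, of \<xi>]
  have "fourier (\<lambda>x. (f (x + h *\<^sub>R b) - f x) /\<^sub>R h) \<xi>
      = (LINT x|lborel. (character \<xi> x * f (x + h *\<^sub>R b) - character \<xi> x * f x) /\<^sub>R h)"
    unfolding fourier_def by (simp add: algebra_simps)
  also have "\<dots> = (fourier (\<lambda>x. f (x + h *\<^sub>R b)) \<xi> - fourier f \<xi>) /\<^sub>R h"
    unfolding fourier_def using ints by simp
  finally show ?thesis
    by (simp add: fourier_translate algebra_simps)
qed

lemma fourier_partial:
  fixes f :: "'a::euclidean_space \<Rightarrow> complex"
  assumes f: "f \<in> schwartz_space" and b: "b \<in> Basis"
  shows "fourier (iter_partial [b] f) \<xi> = 2 * pi * \<i> * (b \<bullet> \<xi>) * fourier f \<xi>"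
proof -
  \<comment> \<open>Dominated convergence is applied along a sequence; the shift by
    \<open>Suc\<close> keeps the steps nonzero and at most 1, the range of the uniform
    bound.\<close>
  define h where "h n = 1 / real (Suc n)" for n
  have h: "0 < h n" "h n \<le> 1" for n
    by (auto simp: h_def)
  have h_lim: "filterlim h (at 0) sequentially"
    unfolding filterlim_at using h LIMSEQ_Suc[OF lim_1_over_n]
    by (auto simp: h_def[abs_def] less_imp_neq[symmetric])
  \<comment> \<open>Used twice: for \<open>f\<close> along the line through \<open>x\<close>, and
    for the exponential factor.\<close>
  have quotient: "(\<lambda>n. (g (h n) - g 0) /\<^sub>R h n) \<longlonglongrightarrow> g'"
    if "(g has_vector_derivative g') (at 0)" for g :: "real \<Rightarrow> complex" and g'
  proof -
    have "((\<lambda>t. norm (g t - g 0 - t *\<^sub>R g') / norm t) \<longlongrightarrow> 0) (at 0)"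
      using that unfolding has_vector_derivative_def has_derivative_iff_norm by simp
    moreover have "norm (g t - g 0 - t *\<^sub>R g') / norm t = norm ((g t - g 0) /\<^sub>R t - g')"
      if "t \<noteq> 0" for t
    proof -
      have "(g t - g 0) /\<^sub>R t - g' = (g t - g 0 - t *\<^sub>R g') /\<^sub>R t"
        using that by (simp add: scaleR_diff_right)
      then show ?thesis
        by (simp only: norm_scaleR) (simp add: divide_inverse mult.commute)
    qed
    ultimately have "((\<lambda>t. norm ((g t - g 0) /\<^sub>R t - g')) \<longlongrightarrow> 0) (at 0)"
      by (elim Lim_transform_eventually) (simp only: eventually_at_filter, simp)
    then have "((\<lambda>t. (g t - g 0) /\<^sub>R t) \<longlongrightarrow> g') (at 0)"
      by (simp only: tendsto_norm_zero_iff Lim_null[symmetric])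
    from filterlim_compose[OF this h_lim] show ?thesis .
  qed
  note [measurable] = schwartz_borel_measurable[OF f]
  have [measurable]: "iter_partial [b] f \<in> borel_measurable borel"
    using b by (intro schwartz_borel_measurable schwartz_iter_partial f) auto
  obtain C where C: "\<And>x h. 0 < h \<Longrightarrow> h \<le> 1 \<Longrightarrow>
      norm ((f (x + h *\<^sub>R b) - f x) /\<^sub>R h) \<le> C / (1 + (norm x)\<^sup>2) ^ DIM('a)"
    using schwartz_difference_quotient_bound[OF f b] by metis
  have "(\<lambda>n. fourier (\<lambda>x. (f (x + h n *\<^sub>R b) - f x) /\<^sub>R h n) \<xi>)
      \<longlonglongrightarrow> fourier (iter_partial [b] f) \<xi>"
    unfolding fourier_def
  proof (rule integral_dominated_convergence)
    show "integrable lborel (\<lambda>x::'a. C * (1 / (1 + (norm x)\<^sup>2) ^ DIM('a)))"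
      by (intro integrable_mult_right integrable_inverse_one_plus_norm_power)
    show "AE x in lborel. norm (character \<xi> x * ((f (x + h n *\<^sub>R b) - f x) /\<^sub>R h n))
        \<le> C * (1 / (1 + (norm x)\<^sup>2) ^ DIM('a))" for n
      using C[OF h[of n]] by (intro AE_I2) (simp only: norm_mult norm_character, simp)
    show "AE x in lborel. (\<lambda>n. character \<xi> x * ((f (x + h n *\<^sub>R b) - f x) /\<^sub>R h n))
        \<longlonglongrightarrow> character \<xi> x * iter_partial [b] f x"
    proof (intro AE_I2 tendsto_mult_left)
      show "(\<lambda>n. (f (x + h n *\<^sub>R b) - f x) /\<^sub>R h n) \<longlonglongrightarrow> iter_partial [b] f x" for x
        using quotient[OF schwartz_line_derivative[OF f, of x b 0 UNIV]] by simp
    qed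
  qed measurable
  moreover have "(\<lambda>n. ((exp (2 * pi * \<i> * (h n * (b \<bullet> \<xi>))) - 1) /\<^sub>R h n) * fourier f \<xi>)
      \<longlonglongrightarrow> 2 * pi * \<i> * (b \<bullet> \<xi>) * fourier f \<xi>"
  proof (intro tendsto_mult_right)
    \<comment> \<open>The derivative is computed for a complex variable and then restricted to the
      real axis.\<close>
    have "((\<lambda>t::real. exp (2 * pi * \<i> * (t * (b \<bullet> \<xi>)))) has_vector_derivative
        2 * pi * \<i> * (b \<bullet> \<xi>)) (at 0)"
    proof -
      have "((\<lambda>z::complex. exp (2 * pi * \<i> * (z * (b \<bullet> \<xi>)))) has_field_derivative
          2 * pi * \<i> * (b \<bullet> \<xi>)) (at (of_real 0))"
        by (auto intro!: derivative_eq_intros)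
      from has_vector_derivative_real_field[OF this, of UNIV] show ?thesis
        by simp
    qed
    from quotient[OF this]
    show "(\<lambda>n. (exp (2 * pi * \<i> * (h n * (b \<bullet> \<xi>))) - 1) /\<^sub>R h n) \<longlonglongrightarrow> 2 * pi * \<i> * (b \<bullet> \<xi>)"
      by simp
  qed
  \<comment> \<open>After rewriting by \<open>fourier_difference_quotient\<close> both limits belong
    to the same sequence.\<close>
  ultimately show ?thesis
    unfolding fourier_difference_quotient[OF f] by (rule LIMSEQ_unique)
qed

lemma fourier_iter_partial_replicate:
  fixes f :: "'a::euclidean_space \<Rightarrow> complex"
  assumes f: "f \<in> schwartz_space" and b: "b \<in> Basis"
  shows "fourier (iter_partial (replicate k b) f) \<xi> = (2 * pi * \<i> * (b \<bullet> \<xi>)) ^ k * fourier f \<xi>"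
proof (induction k)
  case (Suc k)
  have "iter_partial (replicate k b) f \<in> schwartz_space"
    using b by (intro schwartz_iter_partial f) auto
  from fourier_partial[OF this b, of \<xi>] Suc show ?case
    by (simp add: mult.assoc)
qed simp

text \<open>Pure derivatives of order \<open>k\<close> suffice: the transform of the one in
  direction \<open>b\<close> is bounded by its L1 norm, which controls
  \<open>\<bar>\<xi> \<bullet> b\<bar> ^ k\<close> times the transform of \<open>f\<close>, and the
  norm of \<open>\<xi>\<close> is at most \<open>DIM('a)\<close> times its largest
  coordinate.\<close>

lemma fourier_rapidly_decreasing:
  fixes f :: "'a::euclidean_space \<Rightarrow> complex"
  assumes f: "f \<in> schwartz_space"
  shows "rapidly_decreasing (fourier f)"
  unfolding rapidly_decreasing_def
proof
  fix k
  define I where "I b = (LINT x|lborel. norm (iter_partial (replicate k b) f x))" for b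
  have coord: "\<bar>\<xi> \<bullet> b\<bar> ^ k * norm (fourier f \<xi>) \<le> I b" if b: "b \<in> Basis" for b \<xi>
  proof -
    have "1 * \<bar>\<xi> \<bullet> b\<bar> \<le> (2 * pi) * \<bar>\<xi> \<bullet> b\<bar>"
      using pi_ge_two by (intro mult_right_mono) auto
    then have "\<bar>\<xi> \<bullet> b\<bar> ^ k * norm (fourier f \<xi>) \<le> (2 * pi * \<bar>\<xi> \<bullet> b\<bar>) ^ k * norm (fourier f \<xi>)"
      by (intro mult_right_mono power_mono) auto
    also have "\<dots> = norm (fourier (iter_partial (replicate k b) f) \<xi>)"
      by (simp add: fourier_iter_partial_replicate[OF f b] norm_mult norm_power inner_commute)
    also have "\<dots> \<le> I b"
      unfolding I_def by (rule norm_fourier_le)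
    finally show ?thesis .
  qed
  have "norm \<xi> ^ k * norm (fourier f \<xi>) \<le> DIM('a) ^ k * (\<Sum>b\<in>Basis. I b)" for \<xi> :: 'a
  proof -
    \<comment> \<open>The maximizing direction varies with \<xi>; summing \<open>I b\<close> over
      all directions makes the constant uniform.\<close>
    define M where "M = Max ((\<lambda>b. \<bar>\<xi> \<bullet> b\<bar>) ` Basis)"
    have "M \<in> (\<lambda>b. \<bar>\<xi> \<bullet> b\<bar>) ` Basis"
      unfolding M_def by (rule Max_in) auto
    then obtain b where b: "b \<in> Basis" "M = \<bar>\<xi> \<bullet> b\<bar>"
      by auto
    have "norm \<xi> \<le> (\<Sum>b\<in>Basis. \<bar>\<xi> \<bullet> b\<bar>)"
      by (rule norm_le_l1)
    also have "\<dots> \<le> (\<Sum>b\<in>(Basis::'a set). M)"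
      unfolding M_def by (intro sum_mono Max_ge) auto
    finally have "norm \<xi> ^ k \<le> (DIM('a) * M) ^ k"
      by (intro power_mono) auto
    then have "norm \<xi> ^ k * norm (fourier f \<xi>) \<le> (DIM('a) * M) ^ k * norm (fourier f \<xi>)"
      by (rule mult_right_mono) simp
    also have "\<dots> = DIM('a) ^ k * (\<bar>\<xi> \<bullet> b\<bar> ^ k * norm (fourier f \<xi>))"
      by (simp add: b power_mult_distrib)
    also have "\<dots> \<le> DIM('a) ^ k * (\<Sum>b\<in>Basis. I b)"
    proof (rule mult_left_mono)
      have "\<bar>\<xi> \<bullet> b\<bar> ^ k * norm (fourier f \<xi>) \<le> I b"
        by (rule coord) fact
      also have "\<dots> \<le> (\<Sum>b\<in>Basis. I b)"
        using b by (intro member_le_sum) (auto simp: I_def)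
      finally show "\<bar>\<xi> \<bullet> b\<bar> ^ k * norm (fourier f \<xi>) \<le> (\<Sum>b\<in>Basis. I b)" .
    qed simp
    finally show ?thesis .
  qed
  then show "\<exists>C. \<forall>\<xi>. norm \<xi> ^ k * norm (fourier f \<xi>) \<le> C"
    by blast
qed

section \<open>Self-adjointness\<close>

text \<open>Fubini applies because the kernel has modulus 1, so the integrand has modulus
  \<open>norm (g \<xi>) * norm (v x)\<close>. The inverse kernel has the opposite sign, which puts
  \<open>fourier v\<close> at \<open>- \<xi>\<close>.\<close>

lemma integral_inv_fourier_mult:
  fixes g v :: "'a::euclidean_space \<Rightarrow> complex"
  assumes g: "integrable lborel g" and v: "integrable lborel v"
  shows "(LINT x|lborel. inv_fourier g x * v x) = (LINT \<xi>|lborel. g \<xi> * fourier v (- \<xi>))"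
proof -
  have [measurable]: "g \<in> borel_measurable borel" "v \<in> borel_measurable borel"
    using g v by (auto dest: borel_measurable_integrable)
  have [simp]: "norm (exp (2 * complex_of_real pi * \<i> * complex_of_real r)) = 1" for r
    by (simp add: norm_exp_eq_Re)
  let ?K = "\<lambda>(x::'a) \<xi>. exp (2 * complex_of_real pi * \<i> * complex_of_real (x \<bullet> \<xi>)) * g \<xi> * v x"
  have "integrable (lborel \<Otimes>\<^sub>M lborel) (case_prod ?K)"
  proof (rule lborel_pair.Fubini_integrable)
    show "case_prod ?K \<in> borel_measurable (lborel \<Otimes>\<^sub>M lborel)"
      by measurable
    show "integrable lborel (\<lambda>x. LINT \<xi>|lborel. norm (case_prod ?K (x, \<xi>)))"
      using g v by (simp add: norm_mult)
    show "AE x in lborel. integrable lborel (\<lambda>\<xi>. case_prod ?K (x, \<xi>))"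
    proof (rule AE_I2)
      fix x
      have "integrable lborel (\<lambda>\<xi>. g \<xi> * v x)"
        using g by simp
      then show "integrable lborel (\<lambda>\<xi>. case_prod ?K (x, \<xi>))"
        by (rule Bochner_Integration.integrable_bound) (auto simp: norm_mult)
    qed
  qed
  from lborel_pair.Fubini_integral[OF this]
  have "(LINT x|lborel. LINT \<xi>|lborel. ?K x \<xi>) = (LINT \<xi>|lborel. LINT x|lborel. ?K x \<xi>)"
    by simp
  moreover have "(LINT \<xi>|lborel. ?K x \<xi>) = inv_fourier g x * v x" for x
    by (simp add: inv_fourier_def)
  moreover have "(LINT x|lborel. ?K x \<xi>) = g \<xi> * fourier v (- \<xi>)" for \<xi>
    unfolding fourier_def
    by (subst integral_mult_right_zero[symmetric], intro Bochner_Integration.integral_cong)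
       (auto simp: mult_ac)
  ultimately show ?thesis
    by (simp only:)
qed

section \<open>Growth of the symbol\<close>

lemma symbol_bound:
  fixes m s r :: real
  assumes "0 < s" "s < 1"
  shows "(m\<^sup>2 + 4 * pi\<^sup>2 * r\<^sup>2) powr s \<le> (1 + m\<^sup>2) + 4 * pi\<^sup>2 * r\<^sup>2"
proof -
  let ?y = "m\<^sup>2 + 4 * pi\<^sup>2 * r\<^sup>2"
  have y: "?y \<ge> 0"
    by simp
  \<comment> \<open>Adding 1 makes the base at least 1, so that raising the exponent from
    \<open>s\<close> to 1 can only increase the power.\<close>
  have "?y powr s \<le> (1 + ?y) powr s"
    using assms y by (intro powr_mono2) auto
  also have "\<dots> \<le> (1 + ?y) powr 1"
    using assms y by (intro powr_mono) auto
  finally show ?thesis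
    using y by simp
qed

text \<open>The symbol grows at most quadratically, so decay of order \<open>k\<close> for the
  product follows from orders \<open>k\<close> and \<open>k + 2\<close> for the transform.\<close>

lemma symbol_mult_fourier_integrable:
  fixes u :: "'a::euclidean_space \<Rightarrow> complex"
  assumes s: "0 < s" "s < 1" and u: "u \<in> schwartz_space"
  shows "integrable lborel
    (\<lambda>\<xi>. complex_of_real ((m\<^sup>2 + 4 * pi\<^sup>2 * (norm \<xi>)\<^sup>2) powr s) * fourier u \<xi>)"
proof (rule rapidly_decreasing_integrable)
  have [measurable]: "fourier u \<in> borel_measurable borel"
    by (intro fourier_borel_measurable schwartz_borel_measurable u)
  show "(\<lambda>\<xi>. complex_of_real ((m\<^sup>2 + 4 * pi\<^sup>2 * (norm \<xi>)\<^sup>2) powr s) * fourier u \<xi>)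
      \<in> borel_measurable borel"
    by measurable
  show "rapidly_decreasing
      (\<lambda>\<xi>. complex_of_real ((m\<^sup>2 + 4 * pi\<^sup>2 * (norm \<xi>)\<^sup>2) powr s) * fourier u \<xi>)"
    unfolding rapidly_decreasing_def
  proof
    fix k
    obtain A B where A: "\<And>\<xi>. norm \<xi> ^ k * norm (fourier u \<xi>) \<le> A"
      and B: "\<And>\<xi>. norm \<xi> ^ (k + 2) * norm (fourier u \<xi>) \<le> B"
      using fourier_rapidly_decreasing[OF u] unfolding rapidly_decreasing_def by meson
    have "norm \<xi> ^ k * norm (complex_of_real ((m\<^sup>2 + 4 * pi\<^sup>2 * (norm \<xi>)\<^sup>2) powr s) * fourier u \<xi>)
        \<le> (1 + m\<^sup>2) * A + 4 * pi\<^sup>2 * B" for \<xi> :: 'a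
    proof -
      have "norm \<xi> ^ k * norm (complex_of_real ((m\<^sup>2 + 4 * pi\<^sup>2 * (norm \<xi>)\<^sup>2) powr s) * fourier u \<xi>)
          = (m\<^sup>2 + 4 * pi\<^sup>2 * (norm \<xi>)\<^sup>2) powr s * (norm \<xi> ^ k * norm (fourier u \<xi>))"
        by (simp add: norm_mult mult_ac)
      also have "\<dots> \<le> ((1 + m\<^sup>2) + 4 * pi\<^sup>2 * (norm \<xi>)\<^sup>2) * (norm \<xi> ^ k * norm (fourier u \<xi>))"
        by (intro mult_right_mono symbol_bound s) auto
      also have "\<dots> = (1 + m\<^sup>2) * (norm \<xi> ^ k * norm (fourier u \<xi>))
          + 4 * pi\<^sup>2 * (norm \<xi> ^ (k + 2) * norm (fourier u \<xi>))"
        by (simp add: algebra_simps power_add power2_eq_square)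
      also have "\<dots> \<le> (1 + m\<^sup>2) * A + 4 * pi\<^sup>2 * B"
        by (intro add_mono mult_left_mono A B) auto
      finally show ?thesis .
    qed
    then show "\<exists>C. \<forall>\<xi>. norm \<xi> ^ k *
        norm (complex_of_real ((m\<^sup>2 + 4 * pi\<^sup>2 * (norm \<xi>)\<^sup>2) powr s) * fourier u \<xi>) \<le> C"
      by blast
  qed
qed

theorem lemma2p2:
  fixes m s :: real and u v :: "real ^ 'n \<Rightarrow> complex"
  assumes "m > 0" and "0 < s" and "s < 1"
    and "u \<in> schwartz_space" and "v \<in> schwartz_space"
  shows "(LINT x|lborel. frac_op m s u x * v x) = (LINT x|lborel. u x * frac_op m s v x)"
proof -
  define w where "w \<xi> = complex_of_real ((m\<^sup>2 + 4 * pi\<^sup>2 * (norm \<xi>)\<^sup>2) powr s)" for \<xi> :: "real ^ 'n"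
  have [measurable]: "w \<in> borel_measurable borel"
    unfolding w_def by measurable
  \<comment> \<open>Stated for general \<open>f\<close> and \<open>g\<close>, to be applied to
    \<open>u\<close>, \<open>v\<close> and then with the two exchanged.\<close>
  have pairing: "(LINT x|lborel. frac_op m s f x * g x)
      = (LINT \<xi>|lborel. w \<xi> * fourier f \<xi> * fourier g (- \<xi>))"
    if "f \<in> schwartz_space" "g \<in> schwartz_space" for f g
    unfolding frac_op_def w_def
    using assms that
    by (intro integral_inv_fourier_mult symbol_mult_fourier_integrable schwartz_integrable)
  have [measurable]: "fourier u \<in> borel_measurable borel" "fourier v \<in> borel_measurable borel"
    by (intro fourier_borel_measurable schwartz_borel_measurable assms)+
  have "(LINT x|lborel. frac_op m s u x * v x)
      = (LINT \<xi>|lborel. w \<xi> * fourier u \<xi> * fourier v (- \<xi>))"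
    using assms by (intro pairing)
  also have "\<dots> = (LINT \<xi>|lborel. w (- \<xi>) * fourier u (- \<xi>) * fourier v (- (- \<xi>)))"
    by (rule lborel_integral_reflect[symmetric]) measurable
  \<comment> \<open>\<open>w\<close> depends on \<xi> only through its norm, hence is even.\<close>
  also have "\<dots> = (LINT \<xi>|lborel. w \<xi> * fourier v \<xi> * fourier u (- \<xi>))"
    by (simp add: w_def mult_ac)
  also have "\<dots> = (LINT x|lborel. u x * frac_op m s v x)"
    using assms by (subst pairing[symmetric]) (auto simp: mult.commute)
  finally show ?thesis .
qed

end
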